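(* Let $b\ge2$ and $N\ge1$ be integers and let $A=(a_0,\ldots,a_{b-1})$ be a zero-sum vector. Let $c_0,\dots,c_{b^N-1}$ be complex numbers, $\mathbf{c}_N=(c_0,\dots,c_{b^N-1})^T$ and $P_N(x;C_N)=\sum_{n=0}^{b^N-1}c_nx^n$. Then the polynomial equation \[ F_N(x;A)=P_N(x;C_N)\prod_{m=0}^{N-1}\bigl(1-x^{b^m}\bigr) \] holds if and only if the matrix equation $\mathbf{a}_N=M_N\mathbf{c}_N$ holds together with the condition $c_n=0$ for every $n$, $0\le n\le b^N-1$, whose base-$b$ expansion contains the digit $b-1$.
   Context: A zero-sum vector is a tuple $(a_0,\dots,a_{b-1})$ of complex numbers with $a_0+\cdots+a_{b-1}=0$. For a non-negative integer $n$ with base-$b$ digits $n_0,\dots,n_d$, $u_b(n)=\sum_j n_j \bmod b\in\{0,\dots,b-1\}$ (the generalized Prouhet-Thue-Morse sequence). $F_N(x;A)=\sum_{n=0}^{b^N-1}a_{u_b(n)}x^n$ and $\mathbf{a}_N=(a_{u_b(0)},a_{u_b(1)},\dots,a_{u_b(b^N-1)})^T$. $M_1$ is the $b\times b$ lower-bidiagonal matrix with all diagonal entries $1$, all entries directly below the diagonal equal to $-1$, and all other entries $0$; for $N\ge1$, $M_{N+1}=M_1\otimes M_N$ (Kronecker product), a $b^N\times b^N$ matrix. *)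

theory Defs
  imports
    Complex_Main
    "HOL-Computational_Algebra.Polynomial"
    "Jordan_Normal_Form.Matrix"
begin

definition zero_sum :: "complex vec \<Rightarrow> bool" where
  "zero_sum A \<longleftrightarrow> (\<Sum>i<dim_vec A. A $ i) = 0"

text \<open>
  The base-\<open>b\<close> digits \<open>[n\<^sub>0, \<dots>, n\<^sub>d]\<close>, least significant first and without leading zeros; the
  expansion of \<open>0\<close> is \<open>[0]\<close>. The disjunct \<open>b < 2\<close> only serves termination.
\<close>

fun digits :: "nat \<Rightarrow> nat \<Rightarrow> nat list" where
  "digits b n = (if b < 2 \<or> n < b then [n] else (n mod b) # digits b (n div b))"

declare digits.simps [simp del]

lemma horner_sum_digits: "horner_sum (\<lambda>k. k) b (digits b n) = n"
proof (induction b n rule: digits.induct)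
  case (1 b n)
  then show ?case by (cases "b < 2 \<or> n < b") (simp_all add: digits.simps[of b n])
qed

lemma digits_less: "2 \<le> b \<Longrightarrow> k \<in> set (digits b n) \<Longrightarrow> k < b"
proof (induction b n rule: digits.induct)
  case (1 b n)
  then show ?case by (cases "n < b") (auto simp: digits.simps[of b n])
qed

definition ptm :: "nat \<Rightarrow> nat \<Rightarrow> nat" where
  "ptm b n = sum_list (digits b n) mod b"

definition ptm_vec :: "nat \<Rightarrow> nat \<Rightarrow> complex vec \<Rightarrow> complex vec" where
  "ptm_vec b N A = vec (b ^ N) (\<lambda>n. A $ ptm b n)"

definition F_poly :: "nat \<Rightarrow> nat \<Rightarrow> complex vec \<Rightarrow> complex poly" where
  "F_poly b N A = (\<Sum>n<b ^ N. monom (A $ ptm b n) n)"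

definition P_poly :: "nat \<Rightarrow> nat \<Rightarrow> complex vec \<Rightarrow> complex poly" where
  "P_poly b N c = (\<Sum>n<b ^ N. monom (c $ n) n)"

definition kronecker :: "'a::times mat \<Rightarrow> 'a mat \<Rightarrow> 'a mat" where
  "kronecker A B = mat (dim_row A * dim_row B) (dim_col A * dim_col B)
     (\<lambda>(i, j). A $$ (i div dim_row B, j div dim_col B) * B $$ (i mod dim_row B, j mod dim_col B))"

definition M1 :: "nat \<Rightarrow> complex mat" where
  "M1 b = mat b b (\<lambda>(i, j). if i = j then 1 else if i = j + 1 then - 1 else 0)"

text \<open>Only \<open>N \<ge> 1\<close> is meaningful; the value at \<open>N = 0\<close> is a totalization.\<close>

fun M :: "nat \<Rightarrow> nat \<Rightarrow> complex mat" where
  "M b 0 = 1\<^sub>m 1"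
| "M b (Suc 0) = M1 b"
| "M b (Suc (Suc N)) = kronecker (M1 b) (M b (Suc N))"

end

(*
  If c vanishes at every index having the digit b-1, then multiplying P by the product of the
  factors 1 - x^(b^m) never produces a carry, so the coefficients of the result are exactly the
  entries of M_N c (induction on the most significant digit). Conversely, M_N c = a_N has an
  explicit solution, obtained by summing A over the digitwise lower set of the index; if one digit
  is b-1, this sum runs over complete residue systems and vanishes. So there is a c' satisfying the
  matrix conditions, hence the polynomial equation, and c = c' by cancelling the nonzero product.
*)
theory Submission
  imports Defs
begin

lemma sum_lessThan_mult:
  fixes f :: "nat \<Rightarrow> 'a::comm_monoid_add"
  shows "(\<Sum>i<m * k. f i) = (\<Sum>p<m. \<Sum>s<k. f (p * k + s))"
proof -
  have "(\<Sum>s<k. f (p * k + s)) = sum f {p * k..<p * k + k}" for p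
    using sum.shift_bounds_nat_ivl[of f 0 "p * k" k]
    by (simp add: atLeast0LessThan add.commute)
  then show ?thesis
    by (simp add: sum.nat_group)
qed

lemma mult_add_less_mult:
  fixes q b r k :: nat
  assumes "q < b" "r < k"
  shows "q * k + r < b * k"
proof -
  have "q * k + r < Suc q * k"
    using assms(2) by simp
  also have "\<dots> \<le> b * k"
    using assms(1) by (intro mult_le_mono1) simp
  finally show ?thesis .
qed

text \<open>Summation by parts. The only overflow is the term at \<open>y ^ Suc k\<close>; it
  disappears when \<open>G k = 0\<close>, which is how a vanishing top block prevents a
  carry.\<close>

lemma one_minus_mult_power_sum:
  fixes y :: "'a::comm_ring_1"
  shows "(1 - y) * (\<Sum>q<Suc k. y ^ q * G q) =
    (\<Sum>q<Suc k. y ^ q * (G q - (if q = 0 then 0 else G (q - 1)))) - y ^ Suc k * G k"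
proof (induction k)
  case (Suc k)
  then show ?case
    by (simp only: sum.lessThan_Suc[of _ "Suc k"] distrib_left) (simp add: algebra_simps)
qed (simp add: algebra_simps)

subsection \<open>Digits\<close>

lemma sum_list_digits_rec:
  "2 \<le> b \<Longrightarrow> sum_list (digits b n) = n mod b + sum_list (digits b (n div b))"
  by (cases "n < b") (simp_all add: digits.simps[of b n] digits.simps[of b 0])

lemma max_digit_rec:
  "2 \<le> b \<Longrightarrow> b - 1 \<in> set (digits b n) \<longleftrightarrow> n mod b = b - 1 \<or> b - 1 \<in> set (digits b (n div b))"
  by (cases "n < b") (auto simp: digits.simps[of b n] digits.simps[of b 0])

lemma div_mod_top_digit:
  fixes b :: nat
  assumes "2 \<le> b"
  shows "(q * b ^ Suc N + r) mod b = r mod b" "(q * b ^ Suc N + r) div b = q * b ^ N + r div b"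
proof -
  have "q * b ^ Suc N + r = r + b * (q * b ^ N)"
    by simp
  then show "(q * b ^ Suc N + r) mod b = r mod b" "(q * b ^ Suc N + r) div b = q * b ^ N + r div b"
    using assms by (simp_all only: mod_mult_self2 div_mult_self2)
qed

text \<open>\<open>digits\<close> peels off the lowest digit, while the Kronecker recursion splits
  off the highest one; this and \<open>max_digit_top\<close> mediate between the two. If
  \<open>r\<close> has fewer than \<open>N\<close> digits, the padding zeros add nothing to the
  sum.\<close>

lemma sum_list_digits_top:
  assumes "2 \<le> b" "q < b" "r < b ^ N"
  shows "sum_list (digits b (q * b ^ N + r)) = q + sum_list (digits b r)"
  using assms(3)
proof (induction N arbitrary: r)
  case 0
  with assms show ?case by (simp add: digits.simps)
next
  case (Suc N)
  then have "r div b < b ^ N"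
    using assms by (simp add: less_mult_imp_div_less mult.commute)
  with Suc.IH show ?case
    using sum_list_digits_rec[OF assms(1), of "q * b ^ Suc N + r"]
      sum_list_digits_rec[OF assms(1), of r] div_mod_top_digit[OF assms(1), of q N r]
    by simp
qed

text \<open>Padding zeros are harmless here because \<open>b - 1\<close> is nonzero.\<close>

lemma max_digit_top:
  assumes "2 \<le> b" "q < b" "r < b ^ N"
  shows "b - 1 \<in> set (digits b (q * b ^ N + r)) \<longleftrightarrow> q = b - 1 \<or> b - 1 \<in> set (digits b r)"
  using assms(3)
proof (induction N arbitrary: r)
  case 0
  with assms show ?case by (auto simp: digits.simps)
next
  case (Suc N)
  then have "r div b < b ^ N"
    using assms by (simp add: less_mult_imp_div_less mult.commute)
  with Suc.IH show ?case
    using max_digit_rec[OF assms(1), of "q * b ^ Suc N + r"]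
      max_digit_rec[OF assms(1), of r] div_mod_top_digit[OF assms(1), of q N r]
    by auto
qed

subsection \<open>The action of the matrices on sequences\<close>

lemma dim_kronecker [simp]:
  "dim_row (kronecker A B) = dim_row A * dim_row B"
  "dim_col (kronecker A B) = dim_col A * dim_col B"
  by (simp_all add: kronecker_def)

text \<open>Since \<open>M b 0\<close> is the 1 x 1 identity, the Kronecker recursion already holds
  from 0, so inductions can start there.\<close>

lemma M_Suc: "M b (Suc N) = kronecker (M1 b) (M b N)"
  by (cases N) (auto simp: kronecker_def M1_def intro!: eq_matI)

lemma M_carrier [simp]: "M b N \<in> carrier_mat (b ^ N) (b ^ N)"
proof (induction N)
  case (Suc N)
  then show ?case
    unfolding M_Suc by (auto simp: M1_def)
qed simp

lemmas dim_M [simp] = carrier_matD[OF M_carrier]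

text \<open>Functions replace vectors so that the block of \<open>f\<close> with leading digit
  \<open>q\<close> is again a plain function, without carrier conditions.\<close>

definition M_act :: "nat \<Rightarrow> nat \<Rightarrow> (nat \<Rightarrow> complex) \<Rightarrow> nat \<Rightarrow> complex" where
  "M_act b N f n = (\<Sum>j<b ^ N. M b N $$ (n, j) * f j)"

lemma M_mult_vec_nth:
  "c \<in> carrier_vec (b ^ N) \<Longrightarrow> n < b ^ N \<Longrightarrow> (M b N *\<^sub>v c) $ n = M_act b N (($) c) n"
  by (simp add: M_act_def scalar_prod_def atLeast0LessThan)

lemma M_act_cong: "(\<And>j. j < b ^ N \<Longrightarrow> f j = g j) \<Longrightarrow> M_act b N f n = M_act b N g n"
  by (simp add: M_act_def)

lemma M_act_diff: "M_act b N f n - M_act b N g n = M_act b N (\<lambda>j. f j - g j) n"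
  by (simp add: M_act_def sum_subtractf right_diff_distrib)

lemma sum_M1_row:
  assumes "q < b"
  shows "(\<Sum>p<b. M1 b $$ (q, p) * h p) = h q - (if q = 0 then 0 else h (q - 1))"
proof -
  have "(\<Sum>p<b. M1 b $$ (q, p) * h p) =
      (\<Sum>p<b. (if p = q then h p else 0) - (if p = q - 1 then if q = 0 then 0 else h p else 0))"
    using assms by (intro sum.cong) (auto simp: M1_def)
  then show ?thesis
    using assms by (simp add: sum_subtractf)
qed

text \<open>Block row \<open>q\<close> of the Kronecker product has \<open>M b N\<close> on the
  diagonal and its negative just to the left.\<close>

lemma M_act_Suc:
  assumes "q < b" "r < b ^ N"
  shows "M_act b (Suc N) f (q * b ^ N + r) = M_act b N (\<lambda>s. f (q * b ^ N + s)) r -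
    (if q = 0 then 0 else M_act b N (\<lambda>s. f ((q - 1) * b ^ N + s)) r)"
proof -
  have "q * b ^ N + r < b * b ^ N"
    using assms mult_add_less_mult by blast
  moreover have "p * b ^ N + s < b * b ^ N" if "p < b" "s < b ^ N" for p s
    using that mult_add_less_mult by blast
  ultimately have "M_act b (Suc N) f (q * b ^ N + r) =
      (\<Sum>p<b. M1 b $$ (q, p) * M_act b N (\<lambda>s. f (p * b ^ N + s)) r)"
    using assms unfolding M_act_def
    by (auto simp: M_Suc kronecker_def sum_lessThan_mult sum_distrib_left M1_def mult.assoc
        intro!: sum.cong)
  then show ?thesis
    using sum_M1_row[OF assms(1)] by simp
qed

subsection \<open>Coefficients of the product\<close>

definition seq_poly :: "nat \<Rightarrow> (nat \<Rightarrow> complex) \<Rightarrow> complex poly" where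
  "seq_poly k f = (\<Sum>n<k. monom (f n) n)"

lemma seq_poly_cong: "(\<And>n. n < k \<Longrightarrow> f n = g n) \<Longrightarrow> seq_poly k f = seq_poly k g"
  by (simp add: seq_poly_def)

lemma seq_poly_diff: "seq_poly k f - seq_poly k g = seq_poly k (\<lambda>n. f n - g n)"
  by (simp add: seq_poly_def diff_monom flip: sum_subtractf)

lemma seq_poly_zero [simp]: "seq_poly k (\<lambda>n. 0) = 0"
  by (simp add: seq_poly_def)

lemma coeff_seq_poly: "coeff (seq_poly k f) n = (if n < k then f n else 0)"
  by (simp add: seq_poly_def coeff_sum)

lemma seq_poly_eqD: "seq_poly k f = seq_poly k g \<Longrightarrow> n < k \<Longrightarrow> f n = g n"
  by (metis coeff_seq_poly)

lemma seq_poly_mult: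
  "seq_poly (m * k) f = (\<Sum>q<m. monom 1 k ^ q * seq_poly k (\<lambda>s. f (q * k + s)))"
  unfolding seq_poly_def sum_lessThan_mult
  unfolding sum_distrib_left monom_power mult_monom by (simp add: mult.commute)

definition max_digit_free :: "nat \<Rightarrow> nat \<Rightarrow> (nat \<Rightarrow> complex) \<Rightarrow> bool" where
  "max_digit_free b N f \<longleftrightarrow> (\<forall>n<b ^ N. b - 1 \<in> set (digits b n) \<longrightarrow> f n = 0)"

text \<open>Split by the leading digit: multiplying by the new factor 1 - y, where y = x^(b^N),
  takes differences of consecutive blocks, exactly as \<open>M_act_Suc\<close> does.\<close>

lemma seq_poly_mult_prod:
  assumes "2 \<le> b" "max_digit_free b N f"
  shows "seq_poly (b ^ N) f * (\<Prod>m<N. 1 - monom 1 (b ^ m)) = seq_poly (b ^ N) (M_act b N f)"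
  using assms(2)
proof (induction N arbitrary: f)
  case 0
  then show ?case by (simp add: seq_poly_def M_act_def)
next
  case (Suc N)
  let ?B = "b ^ N" and ?S = "\<lambda>q s. f (q * b ^ N + s)"
  let ?y = "monom 1 ?B :: complex poly"
  define G where "G q = seq_poly ?B (M_act b N (?S q))" for q
  have block: "f (q * ?B + s) = 0"
    if "q < b" "s < ?B" "q = b - 1 \<or> b - 1 \<in> set (digits b s)" for q s
    using Suc.prems that max_digit_top[OF assms(1) that(1,2)] mult_add_less_mult[OF that(1,2)]
    by (auto simp: max_digit_free_def)
  have IH: "seq_poly ?B (?S q) * (\<Prod>m<N. 1 - monom 1 (b ^ m)) = G q" if "q < b" for q
    unfolding G_def using block that by (intro Suc.IH) (auto simp: max_digit_free_def)
  \<comment> \<open>All indices in this block have leading digit \<open>b - 1\<close>, so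
    \<open>f\<close> is zero there and no overflow arises.\<close>
  have "M_act b N (?S (b - 1)) = (\<lambda>n. 0)"
    using block assms(1) by (auto simp: M_act_def)
  then have top: "G (b - 1) = 0"
    by (simp only: G_def seq_poly_zero)
  have "seq_poly (b ^ Suc N) f * (\<Prod>m<Suc N. 1 - monom 1 (b ^ m)) =
      (1 - ?y) * (\<Sum>q<b. ?y ^ q * (seq_poly ?B (?S q) * (\<Prod>m<N. 1 - monom 1 (b ^ m))))"
    unfolding power_Suc seq_poly_mult prod.lessThan_Suc sum_distrib_right mult.assoc[symmetric]
    by (subst mult.commute) (simp only: sum_distrib_right mult.assoc)
  also have "\<dots> = (1 - ?y) * (\<Sum>q<b. ?y ^ q * G q)"
    using IH by simp
  also have "\<dots> = (\<Sum>q<b. ?y ^ q * (G q - (if q = 0 then 0 else G (q - 1))))"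
    using one_minus_mult_power_sum[of ?y G "b - 1"] top assms(1) by simp
  also have "\<dots> = (\<Sum>q<b. ?y ^ q * seq_poly ?B (\<lambda>s. M_act b (Suc N) f (q * ?B + s)))"
  proof (intro sum.cong refl arg_cong2[where f = "(*)"])
    fix q assume "q \<in> {..<b}"
    then have "seq_poly ?B (\<lambda>s. M_act b (Suc N) f (q * ?B + s)) = seq_poly ?B (\<lambda>s.
        M_act b N (?S q) s - (if q = 0 then 0 else M_act b N (?S (q - 1)) s))"
      by (intro seq_poly_cong M_act_Suc) auto
    then show "G q - (if q = 0 then 0 else G (q - 1)) =
        seq_poly ?B (\<lambda>s. M_act b (Suc N) f (q * ?B + s))"
      by (cases "q = 0") (simp_all add: G_def seq_poly_diff)
  qed
  also have "\<dots> = seq_poly (b ^ Suc N) (M_act b (Suc N) f)"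
    by (simp add: seq_poly_mult)
  finally show ?case .
qed

subsection \<open>Explicit solution of the matrix equation\<close>

text \<open>The sum of \<open>g (k\<^sub>0 + \<dots> + k\<^bsub>N-1\<^esub>)\<close> over all digit strings with
  \<open>k\<^sub>j \<le> n\<^sub>j\<close> for every \<open>j\<close>.\<close>

fun box_sum :: "nat \<Rightarrow> nat \<Rightarrow> (nat \<Rightarrow> complex) \<Rightarrow> nat \<Rightarrow> complex" where
  "box_sum b 0 g n = g 0"
| "box_sum b (Suc N) g n =
    (\<Sum>k\<le>n div b ^ N. box_sum b N (\<lambda>j. g (k + j)) (n mod b ^ N))"

lemma sum_box_sum:
  "(\<Sum>i\<in>I. box_sum b N (g i) n) = box_sum b N (\<lambda>j. \<Sum>i\<in>I. g i j) n"
proof (induction N arbitrary: g n)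
  case (Suc N)
  have "(\<Sum>i\<in>I. box_sum b (Suc N) (g i) n) =
      (\<Sum>k\<le>n div b ^ N. \<Sum>i\<in>I. box_sum b N (\<lambda>j. g i (k + j)) (n mod b ^ N))"
    by (simp add: sum.swap[of _ I])
  then show ?case
    by (simp add: Suc.IH)
qed simp

lemma box_sum_zero: "box_sum b N (\<lambda>j. 0) n = 0"
  using sum_box_sum[of b N "\<lambda>_ _. 0" n "{}"] by simp

text \<open>In each digit the matrix takes backward differences and \<open>box_sum\<close> takes
  partial sums, so the two undo each other.\<close>

lemma M_act_box_sum:
  assumes "2 \<le> b" "n < b ^ N"
  shows "M_act b N (box_sum b N g) n = g (sum_list (digits b n))"
  using assms(2)
proof (induction N arbitrary: g n)
  case 0
  with assms(1) show ?case
    by (simp add: M_act_def digits.simps)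
next
  case (Suc N)
  define q r where "q = n div b ^ N" and "r = n mod b ^ N"
  have qr: "q < b" "r < b ^ N" "n = q * b ^ N + r"
    using Suc.prems assms(1) div_mult_mod_eq[of n "b ^ N"]
    by (auto simp: q_def r_def less_mult_imp_div_less)
  have S: "box_sum b (Suc N) g (p * b ^ N + s) = (\<Sum>k\<le>p. box_sum b N (\<lambda>j. g (k + j)) s)"
    if "s < b ^ N" for p s
    using that assms(1) by simp
  then have block: "M_act b N (\<lambda>s. box_sum b (Suc N) g (p * b ^ N + s)) r =
      M_act b N (\<lambda>s. \<Sum>k\<le>p. box_sum b N (\<lambda>j. g (k + j)) s) r" for p
    by (intro M_act_cong)
  \<comment> \<open>The sums over k \<le> q and k \<le> q - 1 differ by the single term k =
    q.\<close>
  have "M_act b (Suc N) (box_sum b (Suc N) g) n = M_act b N (box_sum b N (\<lambda>j. g (q + j))) r"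
    unfolding qr(3) M_act_Suc[OF qr(1,2)] block by (cases q) (simp_all add: M_act_diff)
  also have "\<dots> = g (q + sum_list (digits b r))"
    using Suc.IH qr(2) .
  also have "\<dots> = g (sum_list (digits b n))"
    using sum_list_digits_top[OF assms(1) qr(1,2)] qr(3) by simp
  finally show ?case .
qed

text \<open>A digit \<open>b - 1\<close> makes its summation index run over a full period, where
  \<open>g\<close> sums to zero. The hypothesis allows every shift \<open>j\<close> so that it
  passes to translates of \<open>g\<close> in the induction.\<close>

lemma max_digit_free_box_sum:
  assumes "2 \<le> b" "\<And>j. (\<Sum>k<b. g (k + j)) = 0"
  shows "max_digit_free b N (box_sum b N g)"
  using assms(2)
proof (induction N arbitrary: g)
  case 0
  with assms(1) show ?case
    by (simp add: max_digit_free_def digits.simps)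
next
  case (Suc N)
  show ?case
    unfolding max_digit_free_def
  proof (intro allI impI)
    fix n assume n: "n < b ^ Suc N" "b - 1 \<in> set (digits b n)"
    define q r where "q = n div b ^ N" and "r = n mod b ^ N"
    have qr: "q < b" "r < b ^ N" "n = q * b ^ N + r"
      using n assms(1) div_mult_mod_eq[of n "b ^ N"]
      by (auto simp: q_def r_def less_mult_imp_div_less)
    have S: "box_sum b (Suc N) g n = (\<Sum>k\<le>q. box_sum b N (\<lambda>j. g (k + j)) r)"
      by (simp add: q_def r_def)
    from n(2) consider "q = b - 1" | "b - 1 \<in> set (digits b r)"
      using max_digit_top[OF assms(1) qr(1,2)] qr(3) by auto
    then show "box_sum b (Suc N) g n = 0"
    proof cases
      case 1
      then have "{..q} = {..<b}"
        using assms(1) by auto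
      then show ?thesis
        using Suc.prems by (simp only: S sum_box_sum box_sum_zero)
    next
      case 2
      have "(\<Sum>i<b. g (k + (i + j))) = 0" for k j
        using Suc.prems[of "k + j"] by (simp add: add.left_commute)
      then have "max_digit_free b N (box_sum b N (\<lambda>j. g (k + j)))" for k
        by (intro Suc.IH)
      with 2 qr(2) show ?thesis
        unfolding S by (intro sum.neutral) (auto simp: max_digit_free_def)
    qed
  qed
qed

lemma sum_mod_shift:
  fixes h :: "nat \<Rightarrow> 'a::comm_monoid_add"
  shows "(\<Sum>k<b. h ((k + j) mod b)) = (\<Sum>k<b. h k)"
proof (induction j)
  case (Suc j)
  show ?case
  proof (cases b)
    case (Suc m)
    have "(\<Sum>k<b. h ((k + Suc j) mod b)) =
        (\<Sum>k<m. h ((Suc k + j) mod b)) + h ((b + j) mod b)"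
      using Suc by simp
    \<comment> \<open>As \<open>(b + j) mod b = j mod b\<close>, the last term is the one for k = 0
      that the shift dropped.\<close>
    also have "\<dots> = (\<Sum>k<b. h ((k + j) mod b))"
      by (subst Suc, subst sum.lessThan_Suc_shift) (simp add: Suc[symmetric] add.commute)
    finally show ?thesis
      using Suc.IH by simp
  qed simp
qed simp

theorem theorem3p2:
  fixes b N :: nat and A c :: "complex vec"
  assumes "b \<ge> 2" and "N \<ge> 1"
    and "A \<in> carrier_vec b" and "zero_sum A"
    and "c \<in> carrier_vec (b ^ N)"
  shows "F_poly b N A = P_poly b N c * (\<Prod>m<N. 1 - monom 1 (b ^ m)) \<longleftrightarrow>
    ptm_vec b N A = M b N *\<^sub>v c \<and>
    (\<forall>n<b ^ N. b - 1 \<in> set (digits b n) \<longrightarrow> c $ n = 0)"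
proof -
  \<comment> \<open>The periodic extension of \<open>A\<close> can be translated freely and
    evaluated at the unreduced digit sum.\<close>
  define g where "g j = A $ (j mod b)" for j
  let ?Q = "\<Prod>m<N. 1 - monom 1 (b ^ m) :: complex poly"
  let ?F = "\<lambda>n. g (sum_list (digits b n))" and ?c = "box_sum b N g"
  have F: "F_poly b N A = seq_poly (b ^ N) ?F" and P: "P_poly b N c = seq_poly (b ^ N) (($) c)"
    by (simp_all add: F_poly_def P_poly_def seq_poly_def ptm_def g_def)
  have mat: "ptm_vec b N A = M b N *\<^sub>v c \<longleftrightarrow> (\<forall>n<b ^ N. M_act b N (($) c) n = ?F n)"
    using M_mult_vec_nth[OF assms(5)]
    by (auto simp: vec_eq_iff ptm_vec_def ptm_def g_def simp del: index_mult_mat_vec)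
  have "(\<Sum>k<b. g (k + j)) = 0" for j
    using assms(3,4) sum_mod_shift[of "($) A" j b] by (simp add: g_def zero_sum_def)
  then have free: "max_digit_free b N ?c"
    using max_digit_free_box_sum assms(1) by blast
  \<comment> \<open>All exponents \<open>b ^ m\<close> are positive, so each factor takes the value
    1 at 0.\<close>
  have "poly ?Q 0 = 1"
    using assms(1) by (simp add: poly_prod poly_monom power_0_left)
  then have "?Q \<noteq> 0"
    by (metis poly_0 zero_neq_one)
  have sol: "seq_poly (b ^ N) ?c * ?Q = seq_poly (b ^ N) ?F"
    using seq_poly_mult_prod[OF assms(1) free] M_act_box_sum[OF assms(1)]
    by (simp cong: seq_poly_cong)
  show ?thesis
    unfolding mat unfolding F P max_digit_free_def[symmetric]
  proof (intro iffI conjI)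
    assume "seq_poly (b ^ N) ?F = seq_poly (b ^ N) (($) c) * ?Q"
    \<comment> \<open>Uniqueness comes from cancellation in the polynomial ring; invertibility of
      the matrix is never invoked.\<close>
    then have "seq_poly (b ^ N) (($) c) = seq_poly (b ^ N) ?c"
      using sol \<open>?Q \<noteq> 0\<close> by (metis mult_cancel_right)
    then have c: "c $ n = ?c n" if "n < b ^ N" for n
      using seq_poly_eqD that by blast
    then show "\<forall>n<b ^ N. M_act b N (($) c) n = ?F n"
      using M_act_box_sum[OF assms(1)] M_act_cong[of b N "($) c" ?c] by simp
    show "max_digit_free b N (($) c)"
      using c free by (simp add: max_digit_free_def)
  next
    assume "(\<forall>n<b ^ N. M_act b N (($) c) n = ?F n) \<and> max_digit_free b N (($) c)"
    then show "seq_poly (b ^ N) ?F = seq_poly (b ^ N) (($) c) * ?Q"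
      using seq_poly_mult_prod[OF assms(1)] by (simp cong: seq_poly_cong)
  qed
qed

end
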